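(* For every set $I$ of non-negative integers, there exists $a\in\mathcal{A}$ such that \[\underline{d_a}(I)=\overline{d_a}(I)=\overline{d}(I).\]
   Context: For a sequence $a=(a_n)_{n\ge 0}$ of positive real numbers with $\sum_{n=0}^\infty a_n=\infty$ and a set $I$ of non-negative integers, define \[\overline{d_a}(I)=\limsup_{N\to\infty}\frac{\sum_{n\in[0,N]\cap I}a_n}{\sum_{n=0}^N a_n},\qquad \underline{d_a}(I)=\liminf_{N\to\infty}\frac{\sum_{n\in[0,N]\cap I}a_n}{\sum_{n=0}^N a_n}.\] The unweighted upper and lower densities $\overline{d}$, $\underline{d}$ correspond to $a_n=1$ for all $n$. $\mathcal{A}$ denotes the set of all sequences $a=(a_n)_{n\ge0}$ of positive real numbers which are decreasing (in the wide sense, i.e. $a_{n+1}\le a_n$ for all $n$), tend to $0$, and satisfy $\sum_{n=0}^\infty a_n=\infty$. *)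

theory Defs
  imports Complex_Main "HOL-Library.Extended_Real"
begin

text \<open>
  The densities take values in \<^typ>\<open>ereal\<close> because \<^const>\<open>limsup\<close> and \<^const>\<open>liminf\<close>
  require a complete linear order.  For positive weights all quotients lie in \<open>[0,1]\<close>.
\<close>

definition weighted_ratio :: "(nat \<Rightarrow> real) \<Rightarrow> nat set \<Rightarrow> nat \<Rightarrow> real" where
  "weighted_ratio a I N = (\<Sum>n\<in>{0..N} \<inter> I. a n) / (\<Sum>n=0..N. a n)"

definition upper_weighted_density :: "(nat \<Rightarrow> real) \<Rightarrow> nat set \<Rightarrow> ereal" where
  "upper_weighted_density a I = limsup (\<lambda>N. ereal (weighted_ratio a I N))"

definition lower_weighted_density :: "(nat \<Rightarrow> real) \<Rightarrow> nat set \<Rightarrow> ereal" where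
  "lower_weighted_density a I = liminf (\<lambda>N. ereal (weighted_ratio a I N))"

definition upper_density :: "nat set \<Rightarrow> ereal" where
  "upper_density I = upper_weighted_density (\<lambda>_. 1) I"

text \<open>The set \<open>\<A>\<close> of admissible weight sequences.\<close>

definition admissible_weights :: "(nat \<Rightarrow> real) set" where
  "admissible_weights =
    {a. (\<forall>n. 0 < a n) \<and> decseq a \<and> a \<longlonglongrightarrow> 0 \<and>
        filterlim (\<lambda>N. \<Sum>n=0..N. a n) at_top sequentially}"

end

theory Submission
  imports Defs "HOL-Analysis.Extended_Real_Limits"
begin

text \<open>
  Write \<open>r(N)\<close> for the proportion of \<open>{0..N}\<close> that lies in \<open>I\<close>, so that the upper density is
  \<open>d = limsup r\<close>.  Choose indices \<open>M 0 < M 1 < \<dots>\<close> with \<open>r (M k) \<longlonglongrightarrow> d\<close> that are so sparse that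
  \<open>M k + 1\<close> at least doubles at each step, and superpose the uniform probability distributions on
  the intervals \<open>{0..M k}\<close>:
  \<open>a n = (\<Sum>k. if n \<le> M k then 1 / (M k + 1) else 0)\<close>.
  As a sum of decreasing functions \<open>a\<close> is decreasing, and \<open>a n \<longlonglongrightarrow> 0\<close> because it is bounded by tails
  of a convergent series.

  Let \<open>K\<close> be the number of \<open>k\<close> with \<open>M k \<le> N\<close>.  The \<open>a\<close>-mass of \<open>{0..N} \<inter> J\<close> splits
  according to \<open>k\<close>.  For \<open>k < K\<close> the interval \<open>{0..M k}\<close> is seen completely and contributes exactly
  the proportion of \<open>J\<close> in it.  For \<open>k \<ge> K\<close> the contribution is at most \<open>(N + 1) / (M k + 1)\<close>, which
  by doubling is at most \<open>(1/2) ^ (k - K)\<close>; altogether these intervals contribute at most \<open>2\<close>.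
  This is \<open>mass_bounds\<close>.  With \<open>J = UNIV\<close> it says that the total mass up to \<open>N\<close> is \<open>K + O(1)\<close>, and
  with \<open>J = I\<close> that the mass of \<open>I\<close> is \<open>(\<Sum>k<K. r (M k)) + O(1)\<close>.  Hence the weighted ratio at
  \<open>N\<close> is the Cesaro mean of \<open>r (M 0), \<dots>, r (M (K - 1))\<close> up to an error that vanishes as
  \<open>K\<close> grows, and it converges to \<open>d\<close>.
\<close>

section \<open>Cesaro means\<close>

lemma Cesaro_mean_tendsto:
  fixes x :: "nat \<Rightarrow> real"
  assumes "x \<longlonglongrightarrow> L"
  shows "(\<lambda>n. (\<Sum>k<n. x k) / real n) \<longlonglongrightarrow> L"
proof (rule LIMSEQ_I)
  fix e :: real assume e: "0 < e"
  obtain m where m: "\<And>k. k \<ge> m \<Longrightarrow> \<bar>x k - L\<bar> < e / 2"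
    using LIMSEQ_D[OF assms, of "e/2"] e by auto
  define C where "C = (\<Sum>k<m. \<bar>x k - L\<bar>)"
  have "C \<ge> 0" by (simp add: C_def sum_nonneg)
  \<comment> \<open>The first \<open>m\<close> deviations add up to the constant \<open>C\<close>, which is less than \<open>e / 2 * n\<close> for these
      \<open>n\<close>; the remaining ones are below \<open>e / 2\<close> each.\<close>
  have "norm ((\<Sum>k<n. x k) / real n - L) < e" if n: "n \<ge> max (Suc m) (Suc (nat \<lceil>2 * C / e\<rceil>))" for n
  proof -
    have "n > 0" "m \<le> n" using n by auto
    have "real n > 2 * C / e" using n by linarith
    hence C: "C < e / 2 * n" using e by (simp add: field_simps)
    have "(\<Sum>k<n. x k) / real n - L = (\<Sum>k<n. x k - L) / n"
      using \<open>n > 0\<close> by (simp add: sum_subtractf field_simps)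
    moreover have "\<bar>\<Sum>k<n. x k - L\<bar> \<le> (\<Sum>k<n. \<bar>x k - L\<bar>)" by (rule sum_abs)
    moreover have "(\<Sum>k<n. \<bar>x k - L\<bar>) = C + (\<Sum>k=m..<n. \<bar>x k - L\<bar>)"
      unfolding C_def using \<open>m \<le> n\<close>
      by (metis atLeast0LessThan le0 sum.atLeastLessThan_concat)
    moreover have "(\<Sum>k=m..<n. \<bar>x k - L\<bar>) \<le> (\<Sum>k=m..<n. e / 2)"
      using m by (intro sum_mono) (auto intro: less_imp_le)
    moreover have "(\<Sum>k=m..<n. e / 2) \<le> e / 2 * n"
      using e by (simp add: field_simps)
    ultimately have "\<bar>\<Sum>k<n. x k - L\<bar> < e * n" using C by linarith
    thus ?thesis
      using \<open>n > 0\<close> \<open>(\<Sum>k<n. x k) / real n - L = (\<Sum>k<n. x k - L) / n\<close>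
      by (simp add: field_simps)
  qed
  thus "\<exists>no. \<forall>n\<ge>no. norm ((\<Sum>k<n. x k) / real n - L) < e" by blast
qed

text \<open>
  Bounded errors in numerator and denominator disappear in the limit, since both grow like the
  number of averaged terms.
\<close>

lemma perturbed_Cesaro_mean_tendsto:
  fixes x p q :: "nat \<Rightarrow> real" and K :: "nat \<Rightarrow> nat"
  assumes x: "x \<longlonglongrightarrow> L" and K: "filterlim K at_top sequentially"
    and p: "\<And>N. \<bar>p N - (\<Sum>k<K N. x k)\<bar> \<le> C"
    and q: "\<And>N. \<bar>q N - real (K N)\<bar> \<le> D"
  shows "(\<lambda>N. p N / q N) \<longlonglongrightarrow> L"
proof -
  have invK: "(\<lambda>N. E / real (K N)) \<longlonglongrightarrow> 0" for E :: real
    by (rule filterlim_compose[OF _ K]) (rule lim_const_over_n)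
  have err: "(\<lambda>N. f N / real (K N)) \<longlonglongrightarrow> 0" if "\<And>N. \<bar>f N\<bar> \<le> E" for f E
    by (rule tendsto_rabs_zero_cancel, rule tendsto_sandwich[OF _ _ tendsto_const invK[of E]])
      (auto intro!: always_eventually divide_right_mono that simp: abs_divide)
  have mean: "(\<lambda>N. (\<Sum>k<K N. x k) / real (K N)) \<longlonglongrightarrow> L"
    by (rule filterlim_compose[OF Cesaro_mean_tendsto[OF x] K])
  have "(\<lambda>N. ((\<Sum>k<K N. x k) / K N + (p N - (\<Sum>k<K N. x k)) / K N) /
             (1 + (q N - K N) / K N)) \<longlonglongrightarrow> (L + 0) / (1 + 0)"
    by (intro tendsto_intros mean err[OF p] err[OF q]) auto
  moreover have "\<forall>\<^sub>F N in sequentially. ((\<Sum>k<K N. x k) / K N + (p N - (\<Sum>k<K N. x k)) / K N) /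
             (1 + (q N - K N) / K N) = p N / q N"
  proof -
    have "\<forall>\<^sub>F N in sequentially. K N > 0"
      using eventually_compose_filterlim[OF eventually_gt_at_top K] .
    thus ?thesis
      by eventually_elim (simp add: field_simps)
  qed
  ultimately show ?thesis by (simp add: tendsto_cong)
qed

section \<open>Superposed uniform distributions on a lacunary family of intervals\<close>

locale lacunary =
  fixes M :: "nat \<Rightarrow> nat"
  assumes doubling: "2 * M k + 1 \<le> M (Suc k)"
begin

lemma strict_mono_M: "strict_mono M"
  unfolding strict_mono_Suc_iff
proof
  fix k
  show "M k < M (Suc k)" using doubling[of k] by linarith
qed

lemma geometric_growth: "(real (M j) + 1) * 2 ^ i \<le> real (M (j + i)) + 1"
proof (induction i)
  case (Suc i)
  have "2 * real (M (j + i)) + 1 \<le> real (M (j + Suc i))"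
    using doubling[of "j + i"] by (simp flip: of_nat_Suc)
  with Suc show ?case by simp
qed simp

definition uniform :: "nat \<Rightarrow> nat \<Rightarrow> real" where
  "uniform k n = (if n \<le> M k then 1 / (real (M k) + 1) else 0)"

definition weight :: "nat \<Rightarrow> real" where
  "weight n = (\<Sum>k. uniform k n)"

lemma uniform_nonneg: "0 \<le> uniform k n"
  by (simp add: uniform_def)

lemma uniform_le_geometric: "uniform k n \<le> (1 / 2) ^ k"
proof -
  have "1 * 2 ^ k \<le> (real (M 0) + 1) * 2 ^ k"
    by (rule mult_right_mono) simp_all
  also have "\<dots> \<le> real (M k) + 1"
    using geometric_growth[of 0 k] by simp
  finally have "2 ^ k \<le> real (M k) + 1" by simp
  thus ?thesis by (simp add: uniform_def field_simps)
qed

lemma summable_uniform: "summable (\<lambda>k. uniform k n)"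
  by (rule summable_comparison_test'[of "\<lambda>k. (1 / 2) ^ k"])
    (auto simp: uniform_nonneg uniform_le_geometric)

lemma weight_pos: "0 < weight n"
proof -
  have "n \<le> M n" using strict_mono_M by (rule strict_mono_imp_increasing)
  hence "0 < uniform n n" by (simp add: uniform_def add_pos_nonneg)
  thus ?thesis
    unfolding weight_def by (rule suminf_pos2[OF summable_uniform uniform_nonneg])
qed

lemma decseq_weight: "decseq weight"
  unfolding weight_def
  by (intro decseq_SucI suminf_le summable_uniform) (auto simp: uniform_def)

text \<open>
  Past \<open>M j\<close> the first \<open>j\<close> summands vanish, so the weight is at most a tail of the series that
  defines \<open>weight 0\<close>.
\<close>

lemma weight_tendsto_0: "weight \<longlonglongrightarrow> 0"
proof (rule LIMSEQ_I)
  fix e :: real assume "0 < e"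
  then obtain j where j: "\<And>i. i \<ge> j \<Longrightarrow> norm (\<Sum>k. uniform (k + i) 0) < e"
    using suminf_exist_split[OF _ summable_uniform] by blast
  have "norm (weight n - 0) < e" if n: "n \<ge> Suc (M j)" for n
  proof -
    have "uniform k n = 0" if "k < j" for k
      using n strict_monoD[OF strict_mono_M that] by (simp add: uniform_def)
    hence "weight n = (\<Sum>k. uniform (k + j) n)"
      unfolding weight_def by (simp add: suminf_split_initial_segment[OF summable_uniform, of n j])
    also have "\<dots> \<le> (\<Sum>k. uniform (k + j) 0)"
      by (intro suminf_le summable_ignore_initial_segment summable_uniform) (simp add: uniform_def)
    also have "\<dots> < e" using j[of j] by simp
    finally show ?thesis using weight_pos[of n] by simp
  qed
  thus "\<exists>no. \<forall>n\<ge>no. norm (weight n - 0) < e" by blast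
qed

text \<open>
  As \<open>M\<close> is increasing, the least \<open>k\<close> with \<open>N < M k\<close> is also the number of intervals \<open>{0..M k}\<close>
  contained in \<open>{0..N}\<close>.
\<close>

definition completed :: "nat \<Rightarrow> nat" where
  "completed N = (LEAST k. N < M k)"

lemma le_iff_less_completed: "M k \<le> N \<longleftrightarrow> k < completed N"
proof -
  have "N < M (Suc N)"
    using strict_mono_imp_increasing[OF strict_mono_M, of "Suc N"] by simp
  hence "N < M (completed N)" unfolding completed_def by (rule LeastI)
  hence "\<not> M k \<le> N" if "k \<ge> completed N"
    using strict_mono_leD[OF strict_mono_M that] by simp
  moreover have "M k \<le> N" if "k < completed N"
    using not_less_Least[OF that[unfolded completed_def]] by simp
  ultimately show ?thesis by (meson not_le)
qed

lemma completed_at_top: "filterlim completed at_top sequentially"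
  unfolding filterlim_at_top
proof
  fix Z
  have "\<forall>\<^sub>F N in sequentially. M Z \<le> N" by (rule eventually_ge_at_top)
  thus "\<forall>\<^sub>F N in sequentially. Z \<le> completed N"
    by eventually_elim (simp add: le_iff_less_completed less_imp_le)
qed

text \<open>
  The error has the same bound for all \<open>N\<close> and \<open>J\<close>: an interval contained in \<open>{0..N}\<close>
  contributes exactly \<open>r J k\<close>, and the contributions of the others form a series dominated by the
  geometric series with sum \<open>2\<close>.
\<close>

lemma mass_bounds:
  defines "r \<equiv> \<lambda>J k. weighted_ratio (\<lambda>_. 1) J (M k)"
  shows "\<bar>(\<Sum>n\<in>{0..N} \<inter> J. weight n) - (\<Sum>k<completed N. r J k)\<bar> \<le> 2"
proof -
  let ?K = "completed N"
  define c where "c k = (\<Sum>n\<in>{0..N} \<inter> J. uniform k n)" for k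
  have sc: "summable c"
    unfolding c_def by (intro summable_sum summable_uniform)
  have "(\<Sum>n\<in>{0..N} \<inter> J. weight n) = (\<Sum>k. c k)"
    unfolding weight_def c_def by (rule suminf_sum[symmetric]) (rule summable_uniform)
  also have "\<dots> = (\<Sum>k. c (k + ?K)) + (\<Sum>k<?K. c k)"
    by (rule suminf_split_initial_segment[OF sc])
  also have "(\<Sum>k<?K. c k) = (\<Sum>k<?K. r J k)"
  proof (rule sum.cong)
    fix k assume "k \<in> {..<?K}"
    hence k: "M k \<le> N" by (simp add: le_iff_less_completed)
    have "c k = (\<Sum>n\<in>{0..M k} \<inter> J. 1 / (real (M k) + 1))"
      unfolding c_def uniform_def using k by (intro sum.mono_neutral_cong_right) auto
    thus "c k = r J k" by (simp add: r_def weighted_ratio_def add.commute)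
  qed simp
  finally have eq: "(\<Sum>n\<in>{0..N} \<inter> J. weight n) = (\<Sum>k. c (k + ?K)) + (\<Sum>k<?K. r J k)" .
  have st: "summable (\<lambda>k. c (k + ?K))" using sc by simp
  have c0: "0 \<le> c k" for k
    unfolding c_def by (intro sum_nonneg uniform_nonneg)
  have cle: "c (k + ?K) \<le> (1 / 2) ^ k" for k
  proof -
    have "\<not> M ?K \<le> N" by (simp add: le_iff_less_completed)
    hence N: "real N + 1 \<le> real (M ?K) + 1" by simp
    have "c (k + ?K) \<le> (\<Sum>n\<in>{0..N} \<inter> J. 1 / (real (M (k + ?K)) + 1))"
      unfolding c_def uniform_def by (intro sum_mono) auto
    also have "\<dots> = card ({0..N} \<inter> J) / (real (M (k + ?K)) + 1)" by simp
    also have "\<dots> \<le> (real (M ?K) + 1) / (real (M (k + ?K)) + 1)"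
    proof (rule divide_right_mono)
      have "card ({0..N} \<inter> J) \<le> card {0..N}" by (intro card_mono) auto
      thus "real (card ({0..N} \<inter> J)) \<le> real (M ?K) + 1" using N by simp
    qed simp
    also have "\<dots> \<le> (1 / 2) ^ k"
      using geometric_growth[of ?K k] by (simp add: field_simps add.commute)
    finally show ?thesis .
  qed
  have "(\<Sum>k. c (k + ?K)) \<le> (\<Sum>k. (1 / 2) ^ k)"
    by (intro suminf_le cle st) simp
  also have "\<dots> = 2" by (simp add: suminf_geometric)
  finally have "(\<Sum>k. c (k + ?K)) \<le> 2" .
  moreover have "0 \<le> (\<Sum>k. c (k + ?K))" using c0 by (intro suminf_nonneg st)
  ultimately show ?thesis unfolding eq by simp
qed

lemma total_mass_bounds: "\<bar>(\<Sum>n=0..N. weight n) - real (completed N)\<bar> \<le> 2"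
proof -
  have "weighted_ratio (\<lambda>_. 1) UNIV (M k) = 1" for k
    by (simp add: weighted_ratio_def)
  thus ?thesis using mass_bounds[of N UNIV] by simp
qed

lemma weight_admissible: "weight \<in> admissible_weights"
proof -
  have "filterlim (\<lambda>N. \<Sum>n=0..N. weight n) at_top sequentially"
  proof (rule filterlim_at_top_mono)
    show "filterlim (\<lambda>N. - 2 + real (completed N)) at_top sequentially"
      by (intro filterlim_tendsto_add_at_top[OF tendsto_const]
          filterlim_compose[OF filterlim_real_sequentially completed_at_top])
    show "\<forall>\<^sub>F N in sequentially. - 2 + real (completed N) \<le> (\<Sum>n=0..N. weight n)"
    proof (rule always_eventually, rule allI)
      fix N
      show "- 2 + real (completed N) \<le> (\<Sum>n=0..N. weight n)"
        using total_mass_bounds[of N] by linarith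
    qed
  qed
  thus ?thesis
    by (simp add: admissible_weights_def weight_pos decseq_weight weight_tendsto_0)
qed

lemma weighted_ratio_tendsto:
  assumes "(\<lambda>k. weighted_ratio (\<lambda>_. 1) J (M k)) \<longlonglongrightarrow> d"
  shows "weighted_ratio weight J \<longlonglongrightarrow> d"
  unfolding weighted_ratio_def[abs_def]
  by (rule perturbed_Cesaro_mean_tendsto[OF assms completed_at_top mass_bounds total_mass_bounds])

end

section \<open>Lacunary subsequences attaining the upper density\<close>

lemma weighted_ratio_bounds:
  assumes "\<And>n. 0 < a n"
  shows "0 \<le> weighted_ratio a J N" "weighted_ratio a J N \<le> 1"
proof -
  have a: "0 \<le> a n" for n using assms[of n] by simp
  have "(\<Sum>n\<in>{0..N} \<inter> J. a n) \<le> (\<Sum>n=0..N. a n)"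
    by (intro sum_mono2) (auto simp: a)
  moreover have "0 < (\<Sum>n=0..N. a n)"
    by (intro sum_pos) (auto simp: assms)
  ultimately show "0 \<le> weighted_ratio a J N" "weighted_ratio a J N \<le> 1"
    by (auto simp: weighted_ratio_def intro!: divide_nonneg_nonneg sum_nonneg a)
qed

text \<open>
  Some subsequence \<open>s\<close> of indices attains the limes superior.  The limit survives passing to a
  further subsequence, and this freedom is used to enforce the doubling condition.
\<close>

lemma lacunary_subsequence_attaining_upper_density:
  obtains M d where "lacunary M" "(\<lambda>k. weighted_ratio (\<lambda>_. 1) I (M k)) \<longlonglongrightarrow> d"
    "upper_density I = ereal d"
proof -
  let ?r = "weighted_ratio (\<lambda>_. 1) I"
  let ?D = "limsup (\<lambda>N. ereal (?r N))"
  obtain s where s: "strict_mono s" "((\<lambda>N. ereal (?r N)) \<circ> s) \<longlonglongrightarrow> ?D"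
    using limsup_subseq_lim by blast
  have "0 \<le> ?D"
    by (rule LIMSEQ_le_const[OF s(2)]) (simp add: weighted_ratio_bounds)
  moreover have "?D \<le> 1"
    by (rule LIMSEQ_le_const2[OF s(2)]) (simp add: weighted_ratio_bounds)
  ultimately obtain d where d: "?D = ereal d"
    by (cases ?D) auto
  \<comment> \<open>Since \<open>s m \<ge> m\<close>, passing from the index \<open>s (g k)\<close> to \<open>s (2 * s (g k) + 1)\<close> at least
      doubles it, however slowly \<open>s\<close> itself grows.\<close>
  define g where "g k = ((\<lambda>m. 2 * s m + 1) ^^ k) 0" for k
  have ge: "m \<le> s m" for m using s(1) by (rule strict_mono_imp_increasing)
  have g: "g (Suc k) = 2 * s (g k) + 1" for k by (simp add: g_def)
  have lac: "lacunary (s \<circ> g)"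
  proof
    fix k
    show "2 * (s \<circ> g) k + 1 \<le> (s \<circ> g) (Suc k)" using ge[of "g (Suc k)"] by (simp add: g)
  qed
  have "strict_mono g"
  proof (rule strict_mono_Suc_iff[THEN iffD2], rule allI)
    fix k
    show "g k < g (Suc k)" using ge[of "g k"] by (simp add: g)
  qed
  hence "((\<lambda>N. ereal (?r N)) \<circ> s \<circ> g) \<longlonglongrightarrow> ereal d"
    using LIMSEQ_subseq_LIMSEQ[OF s(2)] d by simp
  hence "(\<lambda>k. ?r ((s \<circ> g) k)) \<longlonglongrightarrow> d" by (simp add: o_def)
  moreover have "upper_density I = ereal d"
    by (simp add: upper_density_def upper_weighted_density_def d)
  ultimately show ?thesis using lac that by blast
qed

theorem theorem1p1:
  fixes I :: "nat set"
  shows "\<exists>a \<in> admissible_weights.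
           lower_weighted_density a I = upper_weighted_density a I \<and>
           upper_weighted_density a I = upper_density I"
proof -
  obtain M d where "lacunary M" and M: "(\<lambda>k. weighted_ratio (\<lambda>_. 1) I (M k)) \<longlonglongrightarrow> d"
    and d: "upper_density I = ereal d"
    by (rule lacunary_subsequence_attaining_upper_density)
  interpret lacunary M by fact
  have lim: "(\<lambda>N. ereal (weighted_ratio weight I N)) \<longlonglongrightarrow> ereal d"
    using weighted_ratio_tendsto[OF M] by simp
  show ?thesis
    using weight_admissible lim_imp_Liminf[OF _ lim] lim_imp_Limsup[OF _ lim]
    by (intro bexI[of _ weight]) (simp_all add: upper_weighted_density_def lower_weighted_density_def d)
qed

end
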